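(* For every star expression $e\in StExp(A)$, the entry/body-labeling $\widehat{\mathcal{C}(e)}$ of the chart interpretation $\mathcal{C}(e)$ of $e$ is a LLEE-witness of $\mathcal{C}(e)$.
   Context: **Star expressions.** Given a set $A$ of actions, $StExp(A)$ is generated by $e ::= 0 \mid a \mid (e_1+e_2) \mid (e_1\cdot e_2) \mid (e_1^{\circledast} e_2)$ with $a\in A$. The star height is $|0|_{\circledast}=|a|_{\circledast}=0$, $|f+g|_{\circledast}=|f\cdot g|_{\circledast}=\max\{|f|_{\circledast},|g|_{\circledast}\}$, $|f^{\circledast}g|_{\circledast}=\max\{|f|_{\circledast}+1,|g|_{\circledast}\}$. **Charts.** A chart is a tuple $\langle V,\sqrt{},v_s,A,T\rangle$ with $V$ a finite set of vertices; $\sqrt{}$ a special symbol which, if $\sqrt{}\in V$, is a vertex without outgoing transitions indicating termination; $v_s\in V\setminus\{\sqrt{}\}$ the start vertex; $T\subseteq V\times A\times V$ a finite set of transitions. Every vertex is reachable from $v_s$. **Chart interpretation and its labeling.** $\mathcal{C}(e)$ is the chart with start vertex $e$ whose vertices are the elements of $StExp(A)\cup\{\sqrt{}\}$ reachable from $e$ via the transitions given by the following rules when the subscript labels are ignored. $\widehat{\mathcal{C}(e)}$ is the entry/body-labeling of $\mathcal{C}(e)$ given by the subscript labels, where $\mathrm{bo}$ stands for marking label $0$ and $[\alpha]$ for marking label $\alpha\in\mathbb{N}^+$. Here $l$ ranges over all labels, $\xi\in StExp(A)\cup\{\sqrt{}\}$, $e_1'\in StExp(A)$, and an expression is normed if there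 is a path of transitions from it to $\sqrt{}$: - $a\xrightarrow{a}_{\mathrm{bo}}\sqrt{}$; - if $e_i\xrightarrow{a}_{l}\xi$ for some $i\in\{1,2\}$, then $e_1+e_2\xrightarrow{a}_{\mathrm{bo}}\xi$; - if $e_1\xrightarrow{a}_{l}e_1'$, then $e_1\cdot e_2\xrightarrow{a}_{l}e_1'\cdot e_2$; - if $e_1\xrightarrow{a}_{\mathrm{bo}}\sqrt{}$, then $e_1\cdot e_2\xrightarrow{a}_{\mathrm{bo}}e_2$; - if $e_1\xrightarrow{a}_{l}e_1'$ and $e_1$ is normed, then $e_1^{\circledast}e_2\xrightarrow{a}_{[|e_1|_{\circledast}+1]}e_1'\cdot(e_1^{\circledast}e_2)$; - if $e_1\xrightarrow{a}_{l}e_1'$ and $e_1$ is not normed, then $e_1^{\circledast}e_2\xrightarrow{a}_{\mathrm{bo}}e_1'\cdot(e_1^{\circledast}e_2)$; - if $e_1\xrightarrow{a}_{\mathrm{bo}}\sqrt{}$, then $e_1^{\circledast}e_2\xrightarrow{a}_{[|e_1|_{\circledast}+1]}e_1^{\circledast}e_2$; - if $e_2\xrightarrow{a}_{l}\xi$, then $e_1^{\circledast}e_2\xrightarrow{a}_{\mathrm{bo}}\xi$. **Loop charts.** A chart is a loop chart if (L1) there is an infinite path from its start vertex; (L2) every infinite path from its start vertex returns to the start vertex after a positive number of transitions; (L3) $\sqrt{}$ is not one of its vertices. **LLEE-witness.** An entry/body-labeling $\hat{\mathcal{C}}$ of a chart $\mathcal{C}$ assigns to each transition of $\mathcal{C}$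 a marking label in $\mathbb{N}$. Transitions with marking label $0$ are body transitions; transitions with marking label $\alpha\ge 1$ are entry transitions of level $\alpha$. For a vertex $v$ and $\alpha\geq1$ such that an entry transition of level $\alpha$ departs from $v$, let $\mathcal{C}_{\hat{\mathcal{C}}}(v,\alpha)$ be the subchart of $\mathcal{C}$ with start vertex $v$ consisting of the vertices and transitions that occur on paths which start with an entry transition of level $\alpha$ from $v$, continue with body transitions only, and halt immediately if $v$ is revisited. $\hat{\mathcal{C}}$ is a LLEE-witness of $\mathcal{C}$ if: (W1) there is no infinite path of body transitions from $v_s$; (W2) for every such pair $(v,\alpha)$: (a) $\mathcal{C}_{\hat{\mathcal{C}}}(v,\alpha)$ is a loop chart, and (b) from no vertex $w\ne v$ of $\mathcal{C}_{\hat{\mathcal{C}}}(v,\alpha)$ there departs an entry transition of level $\beta\ge\alpha$. *)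

theory Defs imports Main
begin

datatype (acts: 'a) stexp =
    Zero
  | Act 'a
  | Plus "'a stexp" "'a stexp"
  | Seq "'a stexp" "'a stexp"
  | Star "'a stexp" "'a stexp"  \<comment> \<open>binary iteration: \<open>Star e1 e2\<close> repeats \<open>e1\<close> and exits through \<open>e2\<close>\<close>

definition StExp :: "'a set \<Rightarrow> 'a stexp set" where
  "StExp A = {e. acts e \<subseteq> A}"

primrec star_height :: "'a stexp \<Rightarrow> nat" where
  "star_height Zero = 0"
| "star_height (Act a) = 0"
| "star_height (Plus f g) = max (star_height f) (star_height g)"
| "star_height (Seq f g) = max (star_height f) (star_height g)"
| "star_height (Star f g) = max (star_height f + 1) (star_height g)"


record ('v, 'a) chart =
  verts :: "'v set"
  tick :: 'v
  start :: 'v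
  actions :: "'a set"
  trans :: "('v \<times> 'a \<times> 'v) set"

definition edges :: "('v \<times> 'a \<times> 'v) set \<Rightarrow> ('v \<times> 'v) set" where
  "edges T = {(x, y). \<exists>a. (x, a, y) \<in> T}"

definition is_chart :: "('v, 'a) chart \<Rightarrow> bool" where
  "is_chart C \<longleftrightarrow>
     finite (verts C) \<and>
     start C \<in> verts C - {tick C} \<and>
     finite (trans C) \<and>
     trans C \<subseteq> verts C \<times> actions C \<times> verts C \<and>
     (\<forall>a y. (tick C, a, y) \<notin> trans C) \<and>
     (\<forall>x \<in> verts C. (start C, x) \<in> (edges (trans C))\<^sup>*)"

definition infinite_path :: "('v \<times> 'a \<times> 'v) set \<Rightarrow> 'v \<Rightarrow> (nat \<Rightarrow> 'v) \<Rightarrow> bool" where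
  "infinite_path T v p \<longleftrightarrow> p 0 = v \<and> (\<forall>i. (p i, p (Suc i)) \<in> edges T)"

definition loop_chart :: "('v, 'a) chart \<Rightarrow> bool" where
  "loop_chart C \<longleftrightarrow>
     is_chart C \<and>
     (\<exists>p. infinite_path (trans C) (start C) p) \<and>
     (\<forall>p. infinite_path (trans C) (start C) p \<longrightarrow> (\<exists>i>0. p i = start C)) \<and>
     tick C \<notin> verts C"


text \<open>
  A labeling is represented by its graph: \<open>(x, a, n, y)\<close> says that the transition
  \<open>(x, a, y)\<close> has marking label \<open>n\<close>.  That every transition has exactly one label is part
  of the definition below.
\<close>

type_synonym ('v, 'a) labeling = "('v \<times> 'a \<times> nat \<times> 'v) set"

definition entry_body_labeling :: "('v, 'a) chart \<Rightarrow> ('v, 'a) labeling \<Rightarrow> bool" where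
  "entry_body_labeling C L \<longleftrightarrow>
     (\<forall>x a n y. (x, a, n, y) \<in> L \<longrightarrow> (x, a, y) \<in> trans C) \<and>
     (\<forall>x a y. (x, a, y) \<in> trans C \<longrightarrow> (\<exists>!n. (x, a, n, y) \<in> L))"

definition body_trans :: "('v, 'a) labeling \<Rightarrow> ('v \<times> 'a \<times> 'v) set" where
  "body_trans L = {(x, a, y). (x, a, 0, y) \<in> L}"

definition entry_departs :: "('v, 'a) labeling \<Rightarrow> 'v \<Rightarrow> nat \<Rightarrow> bool" where
  "entry_departs L v \<alpha> \<longleftrightarrow> \<alpha> \<ge> 1 \<and> (\<exists>a w. (v, a, \<alpha>, w) \<in> L)"

text \<open>
  The paths that generate the loop subchart at \<open>(v, \<alpha>)\<close>, as nonempty lists of transitions.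
  Finite paths suffice, since whatever occurs on an infinite such path already occurs on a
  finite prefix of it.
\<close>

inductive loop_path :: "('v, 'a) labeling \<Rightarrow> 'v \<Rightarrow> nat \<Rightarrow> ('v \<times> 'a \<times> 'v) list \<Rightarrow> bool"
  for L :: "('v, 'a) labeling" and v :: 'v and \<alpha> :: nat where
  enter: "(v, a, \<alpha>, w) \<in> L \<Longrightarrow> loop_path L v \<alpha> [(v, a, w)]"
| continue: "loop_path L v \<alpha> (ts @ [(x, a, y)]) \<Longrightarrow> y \<noteq> v \<Longrightarrow> (y, b, z) \<in> body_trans L
    \<Longrightarrow> loop_path L v \<alpha> (ts @ [(x, a, y), (y, b, z)])"

definition loop_subchart ::
  "('v, 'a) chart \<Rightarrow> ('v, 'a) labeling \<Rightarrow> 'v \<Rightarrow> nat \<Rightarrow> ('v, 'a) chart" where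
  "loop_subchart C L v \<alpha> =
     \<lparr> verts = {u. \<exists>ts x a y. loop_path L v \<alpha> ts \<and> (x, a, y) \<in> set ts \<and> (u = x \<or> u = y)},
       tick = tick C,
       start = v,
       actions = actions C,
       trans = {t. \<exists>ts. loop_path L v \<alpha> ts \<and> t \<in> set ts} \<rparr>"

definition LLEE_witness :: "('v, 'a) chart \<Rightarrow> ('v, 'a) labeling \<Rightarrow> bool" where
  "LLEE_witness C L \<longleftrightarrow>
     is_chart C \<and>
     entry_body_labeling C L \<and>
     (\<nexists>p. infinite_path (body_trans L) (start C) p) \<and>
     (\<forall>v \<in> verts C. \<forall>\<alpha>. entry_departs L v \<alpha> \<longrightarrow>
        loop_chart (loop_subchart C L v \<alpha>) \<and>
        (\<forall>w \<in> verts (loop_subchart C L v \<alpha>). w \<noteq> v \<longrightarrow>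
           (\<forall>\<beta>\<ge>\<alpha>. \<not> entry_departs L w \<beta>)))"


datatype 'a vertex = Exp "'a stexp" | Tick

text \<open>
  The transition rules come in two versions, because normedness, on which the labels depend,
  is a property of the unlabeled transitions.  The rules of \<open>step\<close> are those of \<open>lstep\<close> without
  labels; the two rules of \<open>lstep\<close> that differ only in whether \<open>e1\<close> is normed then become one.
\<close>

inductive step :: "'a stexp \<Rightarrow> 'a \<Rightarrow> 'a vertex \<Rightarrow> bool" where
  "step (Act a) a Tick"
| "step e1 a \<xi> \<Longrightarrow> step (Plus e1 e2) a \<xi>"
| "step e2 a \<xi> \<Longrightarrow> step (Plus e1 e2) a \<xi>"
| "step e1 a (Exp e1') \<Longrightarrow> step (Seq e1 e2) a (Exp (Seq e1' e2))"
| "step e1 a Tick \<Longrightarrow> step (Seq e1 e2) a (Exp e2)"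
| "step e1 a (Exp e1') \<Longrightarrow> step (Star e1 e2) a (Exp (Seq e1' (Star e1 e2)))"
| "step e1 a Tick \<Longrightarrow> step (Star e1 e2) a (Exp (Star e1 e2))"
| "step e2 a \<xi> \<Longrightarrow> step (Star e1 e2) a \<xi>"

definition step_trans :: "('a vertex \<times> 'a \<times> 'a vertex) set" where
  "step_trans = {(Exp e, a, \<xi>) | e a \<xi>. step e a \<xi>}"

definition normed :: "'a stexp \<Rightarrow> bool" where
  "normed e \<longleftrightarrow> (Exp e, Tick) \<in> (edges step_trans)\<^sup>*"

inductive lstep :: "'a stexp \<Rightarrow> 'a \<Rightarrow> nat \<Rightarrow> 'a vertex \<Rightarrow> bool" where
  "lstep (Act a) a 0 Tick"
| "lstep e1 a l \<xi> \<Longrightarrow> lstep (Plus e1 e2) a 0 \<xi>"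
| "lstep e2 a l \<xi> \<Longrightarrow> lstep (Plus e1 e2) a 0 \<xi>"
| "lstep e1 a l (Exp e1') \<Longrightarrow> lstep (Seq e1 e2) a l (Exp (Seq e1' e2))"
| "lstep e1 a 0 Tick \<Longrightarrow> lstep (Seq e1 e2) a 0 (Exp e2)"
| "lstep e1 a l (Exp e1') \<Longrightarrow> normed e1
    \<Longrightarrow> lstep (Star e1 e2) a (star_height e1 + 1) (Exp (Seq e1' (Star e1 e2)))"
| "lstep e1 a l (Exp e1') \<Longrightarrow> \<not> normed e1
    \<Longrightarrow> lstep (Star e1 e2) a 0 (Exp (Seq e1' (Star e1 e2)))"
| "lstep e1 a 0 Tick \<Longrightarrow> lstep (Star e1 e2) a (star_height e1 + 1) (Exp (Star e1 e2))"
| "lstep e2 a l \<xi> \<Longrightarrow> lstep (Star e1 e2) a 0 \<xi>"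

definition chart_verts :: "'a set \<Rightarrow> 'a stexp \<Rightarrow> 'a vertex set" where
  "chart_verts A e = {\<xi> \<in> Exp ` StExp A \<union> {Tick}. (Exp e, \<xi>) \<in> (edges step_trans)\<^sup>*}"

definition chart_interpretation :: "'a set \<Rightarrow> 'a stexp \<Rightarrow> ('a vertex, 'a) chart" where
  "chart_interpretation A e =
     \<lparr> verts = chart_verts A e,
       tick = Tick,
       start = Exp e,
       actions = A,
       trans = {(x, a, y) \<in> step_trans. x \<in> chart_verts A e \<and> y \<in> chart_verts A e} \<rparr>"

definition chart_labeling :: "'a set \<Rightarrow> 'a stexp \<Rightarrow> ('a vertex, 'a) labeling" where
  "chart_labeling A e =
     {(Exp f, a, l, \<xi>) | f a l \<xi>.
        lstep f a l \<xi> \<and> Exp f \<in> chart_verts A e \<and> \<xi> \<in> chart_verts A e}"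

end

theory Submission imports Defs
begin

text \<open>
  An entry transition departs from an expression of the form
  \<open>(\<dots>(Star e1 e2 \<cdot> g1) \<cdot> \<dots>) \<cdot> gk\<close> with \<open>e1\<close> normed, and its level is \<open>|e1| + 1\<close>.
  Until the iteration is reentered, the process is of the form
  \<open>(\<dots>((f \<cdot> Star e1 e2) \<cdot> g1) \<cdot> \<dots>) \<cdot> gk\<close> with \<open>f\<close> a derivative of \<open>e1\<close>; such an expression can
  neither terminate nor perform an entry step of level above \<open>|f| \<le> |e1|\<close>.  The process has to
  return since body steps terminate, and it can return since a normed expression always has a
  path to termination that consists of body steps.  Body steps terminate because an iteration with
  normed body is left by its body steps, while from one with a body that is not normed
  there is no way back to the iteration.
\<close>

section \<open>Loop subcharts\<close>

text \<open>Whether a \<open>loop_path\<close> can be extended depends only on its last transition.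
  So the transitions that occur on such paths admit an induction without lists.\<close>

inductive loop_trans :: "('v, 'a) labeling \<Rightarrow> 'v \<Rightarrow> nat \<Rightarrow> 'v \<Rightarrow> 'a \<Rightarrow> 'v \<Rightarrow> bool"
  for L :: "('v, 'a) labeling" and v :: 'v and \<alpha> :: nat where
  enter: "(v, a, \<alpha>, w) \<in> L \<Longrightarrow> loop_trans L v \<alpha> v a w"
| continue: "loop_trans L v \<alpha> x a y \<Longrightarrow> y \<noteq> v \<Longrightarrow> (y, b, z) \<in> body_trans L
    \<Longrightarrow> loop_trans L v \<alpha> y b z"

lemma loop_path_imp_loop_trans:
  "loop_path L v \<alpha> ts \<Longrightarrow> (x, a, y) \<in> set ts \<Longrightarrow> loop_trans L v \<alpha> x a y"
proof (induction arbitrary: x a y rule: loop_path.induct)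
  case (enter b w)
  then show ?case by (auto intro: loop_trans.enter)
next
  case (continue ts x' a' y' b z)
  have "loop_trans L v \<alpha> x' a' y'" using continue.IH by simp
  then have "loop_trans L v \<alpha> y' b z" using continue.hyps by (auto intro: loop_trans.continue)
  then show ?case using continue by auto
qed

text \<open>The path is required to end in the given transition, since \<open>continue\<close>
  extends a path only there.\<close>

lemma loop_trans_imp_loop_path:
  "loop_trans L v \<alpha> x a y \<Longrightarrow> \<exists>ts. loop_path L v \<alpha> (ts @ [(x, a, y)])"
proof (induction rule: loop_trans.induct)
  case (enter a w)
  then have "loop_path L v \<alpha> ([] @ [(v, a, w)])" by (simp add: loop_path.enter)
  then show ?case by blast
next
  case (continue x a y b z)
  then obtain ts where "loop_path L v \<alpha> (ts @ [(x, a, y)])" by blast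
  from loop_path.continue[OF this continue.hyps(2,3)]
  have "loop_path L v \<alpha> ((ts @ [(x, a, y)]) @ [(y, b, z)])" by simp
  then show ?case by blast
qed

lemma trans_loop_subchart:
  "trans (loop_subchart C L v \<alpha>) = {(x, a, y). loop_trans L v \<alpha> x a y}"
  unfolding loop_subchart_def
  using loop_path_imp_loop_trans loop_trans_imp_loop_path by fastforce

lemma verts_loop_subchart:
  "verts (loop_subchart C L v \<alpha>) = {u. \<exists>x a y. loop_trans L v \<alpha> x a y \<and> (u = x \<or> u = y)}"
proof -
  have "verts (loop_subchart C L v \<alpha>) =
      {u. \<exists>x a y. (x, a, y) \<in> trans (loop_subchart C L v \<alpha>) \<and> (u = x \<or> u = y)}"
    unfolding loop_subchart_def by auto
  then show ?thesis unfolding trans_loop_subchart by simp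
qed

text \<open>A source other than \<open>v\<close> continues some path, hence is the target of the
  preceding transition.\<close>

lemma loop_subchart_vert_target:
  assumes "u \<in> verts (loop_subchart C L v \<alpha>)" "u \<noteq> v"
  shows "\<exists>x a. loop_trans L v \<alpha> x a u"
proof -
  obtain x a y where xy: "loop_trans L v \<alpha> x a y" "u = x \<or> u = y"
    using assms(1) unfolding verts_loop_subchart by blast
  from xy(1) show ?thesis
  proof cases
    case enter
    then show ?thesis using xy assms(2) by auto
  next
    case (continue x' a')
    show ?thesis using continue(1) xy by auto
  qed
qed

lemma loop_subchart_simps [simp]:
  "tick (loop_subchart C L v \<alpha>) = tick C"
  "start (loop_subchart C L v \<alpha>) = v"
  "actions (loop_subchart C L v \<alpha>) = actions C"
  unfolding loop_subchart_def by simp_all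

lemma loop_trans_body: "loop_trans L v \<alpha> x a y \<Longrightarrow> x \<noteq> v \<Longrightarrow> (x, a, y) \<in> body_trans L"
  by (auto elim: loop_trans.cases)

lemma loop_trans_in_chart:
  assumes "entry_body_labeling C L" "loop_trans L v \<alpha> x a y"
  shows "(x, a, y) \<in> trans C"
  using assms(2,1) by cases (auto simp: entry_body_labeling_def body_trans_def)

lemma loop_trans_reachable:
  "loop_trans L v \<alpha> x a y \<Longrightarrow> (v, x) \<in> (edges {(x, a, y). loop_trans L v \<alpha> x a y})\<^sup>*"
proof (induction rule: loop_trans.induct)
  case (continue x a y b z)
  have "(x, y) \<in> edges {(x, a, y). loop_trans L v \<alpha> x a y}"
    using continue.hyps(1) by (auto simp: edges_def)
  with continue.IH show ?case by (rule rtrancl_into_rtrancl)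
qed simp

lemma is_chart_loop_subchart:
  assumes C: "is_chart C" and L: "entry_body_labeling C L" and v: "entry_departs L v \<alpha>"
  shows "is_chart (loop_subchart C L v \<alpha>)"
proof -
  let ?T = "{(x, a, y). loop_trans L v \<alpha> x a y}"
  have sub: "?T \<subseteq> trans C" using loop_trans_in_chart[OF L] by auto
  have subC: "trans C \<subseteq> verts C \<times> actions C \<times> verts C" using C by (simp add: is_chart_def)
  obtain a w where vaw: "(v, a, \<alpha>, w) \<in> L" using v by (auto simp: entry_departs_def)
  then have start: "loop_trans L v \<alpha> v a w" by (rule loop_trans.enter)
  have verts: "verts (loop_subchart C L v \<alpha>) \<subseteq> verts C"
    unfolding verts_loop_subchart using sub subC by blast
  have "v \<noteq> tick C"
    using C start sub by (auto simp: is_chart_def)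
  moreover have "(v, u) \<in> (edges ?T)\<^sup>*" if "u \<in> verts (loop_subchart C L v \<alpha>)" for u
  proof -
    from that obtain x b y where xy: "loop_trans L v \<alpha> x b y" "u = x \<or> u = y"
      unfolding verts_loop_subchart by blast
    then have "(x, y) \<in> edges ?T" by (auto simp: edges_def)
    then show ?thesis using loop_trans_reachable[OF xy(1)] xy(2)
      by (auto intro: rtrancl_into_rtrancl)
  qed
  moreover have "finite (verts (loop_subchart C L v \<alpha>))"
    using verts C by (auto simp: is_chart_def intro: finite_subset)
  moreover have "finite ?T"
    using sub C by (auto simp: is_chart_def intro: finite_subset)
  moreover have "v \<in> verts (loop_subchart C L v \<alpha>)"
    unfolding verts_loop_subchart using start by blast
  moreover have "?T \<subseteq> verts (loop_subchart C L v \<alpha>) \<times> actions C \<times> verts (loop_subchart C L v \<alpha>)"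
    using sub subC unfolding verts_loop_subchart by blast
  moreover have "\<forall>a y. (tick C, a, y) \<notin> ?T"
    using sub C unfolding is_chart_def by blast
  ultimately show ?thesis
    unfolding is_chart_def trans_loop_subchart by simp
qed

lemma infinite_path_of_cycle:
  assumes "(v, v) \<in> (edges T)\<^sup>+"
  shows "\<exists>p. infinite_path T v p"
proof -
  \<comment> \<open>Invariant of the choice: a nonempty path leads from the current vertex to
    \<open>v\<close>, where the cycle starts over. The clause for \<open>n = 0\<close> fixes the
    first vertex.\<close>
  have "\<exists>p. \<forall>n. ((p n, v) \<in> (edges T)\<^sup>+ \<and> (n = 0 \<longrightarrow> p n = v)) \<and> (p n, p (Suc n)) \<in> edges T"
  proof (rule dependent_nat_choice)
    show "\<exists>x. (x, v) \<in> (edges T)\<^sup>+ \<and> (0 = (0::nat) \<longrightarrow> x = v)" using assms by blast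
  next
    fix x and n :: nat
    assume "(x, v) \<in> (edges T)\<^sup>+ \<and> (n = 0 \<longrightarrow> x = v)"
    then obtain y where "(x, y) \<in> edges T" "(y, v) \<in> (edges T)\<^sup>*" by (meson tranclD)
    then show "\<exists>y. ((y, v) \<in> (edges T)\<^sup>+ \<and> (Suc n = 0 \<longrightarrow> y = v)) \<and> (x, y) \<in> edges T"
      using assms by (auto dest: rtranclD)
  qed
  then show ?thesis unfolding infinite_path_def by blast
qed

section \<open>Steps of star expressions\<close>

inductive_cases lstep_ZeroE [elim!]: "lstep Zero a l \<xi>"
inductive_cases lstep_ActE [elim!]: "lstep (Act b) a l \<xi>"
inductive_cases lstep_PlusE [elim!]: "lstep (Plus f g) a l \<xi>"
inductive_cases lstep_SeqE [elim!]: "lstep (Seq f g) a l \<xi>"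
inductive_cases lstep_StarE [elim!]: "lstep (Star f g) a l \<xi>"

inductive_cases step_ZeroE [elim!]: "step Zero a \<xi>"
inductive_cases step_ActE [elim!]: "step (Act b) a \<xi>"
inductive_cases step_PlusE [elim!]: "step (Plus f g) a \<xi>"
inductive_cases step_SeqE [elim!]: "step (Seq f g) a \<xi>"
inductive_cases step_StarE [elim!]: "step (Star f g) a \<xi>"

lemma lstep_imp_step: "lstep f a l \<xi> \<Longrightarrow> step f a \<xi>"
  by (induction rule: lstep.induct) (auto intro: step.intros)

text \<open>Hence the label 0 that the rules demand of a terminating premise is no restriction, on
  which \<open>step_imp_lstep\<close> relies.\<close>

lemma lstep_Tick: "lstep f a l \<xi> \<Longrightarrow> \<xi> = Tick \<Longrightarrow> l = 0"
  by (induction rule: lstep.induct) auto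

lemma step_imp_lstep: "step f a \<xi> \<Longrightarrow> \<exists>l. lstep f a l \<xi>"
proof (induction rule: step.induct)
  case (6 e1 a e1' e2)
  then show ?case by (cases "normed e1") (auto intro: lstep.intros)
qed (auto intro: lstep.intros dest: lstep_Tick)

text \<open>Unfolding an iteration makes the expression grow, but only by a factor put in front of
  it; the right factor stays bounded. This separates the targets of the rules for iteration.\<close>

lemma step_size:
  "step f a \<xi> \<Longrightarrow> \<xi> = Exp f' \<Longrightarrow> (\<exists>x y. f' = Seq x y \<and> size y \<le> size f) \<or> size f' \<le> size f"
  by (induction arbitrary: f' rule: step.induct) fastforce+

lemma not_step_right_iteration:
  "\<not> step g a (Exp (Star f g))" "\<not> step g a (Exp (Seq h (Star f g)))"
  using step_size[of g a _ "Star f g"] step_size[of g a _ "Seq h (Star f g)"] by auto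

lemma Seq_neq_right: "Seq f g \<noteq> g"
proof
  assume "Seq f g = g"
  then have "size (Seq f g) = size g" by simp
  then show False by simp
qed

text \<open>Different rules for a product or an iteration reach different targets, by size. For
  equal targets the rule fixes the label, where normedness of the body decides between the two
  unfolding rules; only products pass on the label of a component.\<close>

lemma lstep_label_unique: "lstep f a l \<xi> \<Longrightarrow> lstep f a m \<xi> \<Longrightarrow> l = m"
proof (induction f arbitrary: l m \<xi>)
  case (Plus f g)
  from Plus.prems show ?case by auto
next
  case (Seq f g)
  from Seq.prems show ?case
    by (elim lstep_SeqE) (simp_all add: Seq_neq_right Seq_neq_right[symmetric], blast intro: Seq.IH(1))
next
  case (Star f g)
  have "\<not> lstep g a l (Exp (Star f g))" "\<not> lstep g a l (Exp (Seq h (Star f g)))" for l h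
    by (auto dest!: lstep_imp_step simp: not_step_right_iteration)
  with Star.prems show ?case by (elim lstep_StarE) simp_all
qed auto

text \<open>Together with \<open>lstep_level_le\<close> this bounds the levels of all steps from
  derivatives of a loop body \<open>e1\<close> by \<open>star_height e1\<close>.\<close>

lemma step_star_height: "step f a \<xi> \<Longrightarrow> \<xi> = Exp f' \<Longrightarrow> star_height f' \<le> star_height f"
  by (induction arbitrary: f' rule: step.induct) (auto simp: le_max_iff_disj)

lemma lstep_level_le: "lstep f a l \<xi> \<Longrightarrow> l \<le> star_height f"
  by (induction rule: lstep.induct) (simp_all add: le_max_iff_disj)

lemma step_acts: "step f a \<xi> \<Longrightarrow> a \<in> acts f \<and> (\<forall>f'. \<xi> = Exp f' \<longrightarrow> acts f' \<subseteq> acts f)"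
  by (induction rule: step.induct) auto

lemma finite_acts: "finite (acts e)"
  by (induction e) auto

text \<open>The closed set is built along the syntax: a derivative of the left component carries its
  right factor along until it terminates. In an iteration that factor is the iteration itself, so
  unfolding adds nothing further.\<close>

lemma finite_step_closed:
  "\<exists>F. finite F \<and> e \<in> F \<and> (\<forall>f\<in>F. \<forall>a f'. step f a (Exp f') \<longrightarrow> f' \<in> F)"
proof (induction e)
  case Zero
  show ?case by (rule exI[of _ "{Zero}"]) auto
next
  case (Act b)
  show ?case by (rule exI[of _ "{Act b}"]) auto
next
  case (Plus e1 e2)
  then obtain F G where
    "finite F \<and> e1 \<in> F \<and> (\<forall>f\<in>F. \<forall>a f'. step f a (Exp f') \<longrightarrow> f' \<in> F)"
    "finite G \<and> e2 \<in> G \<and> (\<forall>f\<in>G. \<forall>a f'. step f a (Exp f') \<longrightarrow> f' \<in> G)" by blast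
  then show ?case by (intro exI[of _ "insert (Plus e1 e2) (F \<union> G)"]) auto
next
  case (Seq e1 e2)
  then obtain F G where
    "finite F \<and> e1 \<in> F \<and> (\<forall>f\<in>F. \<forall>a f'. step f a (Exp f') \<longrightarrow> f' \<in> F)"
    "finite G \<and> e2 \<in> G \<and> (\<forall>f\<in>G. \<forall>a f'. step f a (Exp f') \<longrightarrow> f' \<in> G)" by blast
  then show ?case by (intro exI[of _ "(\<lambda>f. Seq f e2) ` F \<union> G"]) auto
next
  case (Star e1 e2)
  then obtain F G where
    "finite F \<and> e1 \<in> F \<and> (\<forall>f\<in>F. \<forall>a f'. step f a (Exp f') \<longrightarrow> f' \<in> F)"
    "finite G \<and> e2 \<in> G \<and> (\<forall>f\<in>G. \<forall>a f'. step f a (Exp f') \<longrightarrow> f' \<in> G)" by blast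
  then show ?case
    by (intro exI[of _ "insert (Star e1 e2) ((\<lambda>f. Seq f (Star e1 e2)) ` F \<union> G)"]) auto
qed

section \<open>Normedness\<close>

lemma normed_step_Tick: "step f a Tick \<Longrightarrow> normed f"
  unfolding normed_def edges_def step_trans_def by auto

lemma normed_step_Exp: "step f a (Exp f') \<Longrightarrow> normed f' \<Longrightarrow> normed f"
  unfolding normed_def
  by (rule converse_rtrancl_into_rtrancl) (auto simp: edges_def step_trans_def)

text \<open>Normedness witnessed by body steps alone, given inductively so that a loop can be closed
  by following the witness.\<close>

inductive body_exits :: "'a stexp \<Rightarrow> bool" where
  "lstep f a 0 Tick \<Longrightarrow> body_exits f"
| "lstep f a 0 (Exp g) \<Longrightarrow> body_exits g \<Longrightarrow> body_exits f"

lemma body_exits_Seq_iff: "body_exits (Seq f g) \<longleftrightarrow> body_exits f \<and> body_exits g"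
proof
  show "body_exits f \<and> body_exits g" if "body_exits (Seq f g)"
    using that
  proof (induction "Seq f g" arbitrary: f rule: body_exits.induct)
    case (2 a h f)
    from "2.hyps"(1) consider (inner) f' where "h = Seq f' g" "lstep f a 0 (Exp f')"
      | (exit) "h = g" "lstep f a 0 Tick" by auto
    then show ?case
    proof cases
      case inner
      then show ?thesis using "2.hyps"(3) body_exits.intros(2)[OF inner(2)] by simp
    next
      case exit
      then show ?thesis using "2.hyps"(2) body_exits.intros(1)[OF exit(2)] by simp
    qed
  qed blast
next
  assume "body_exits f \<and> body_exits g"
  then have "body_exits f" "body_exits g" by auto
  then show "body_exits (Seq f g)"
  proof (induction rule: body_exits.induct)
    case (1 f a)
    then show ?case by (rule body_exits.intros(2)[OF lstep.intros(5)])
  next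
    case (2 f a h)
    show ?case by (rule body_exits.intros(2)[OF lstep.intros(4)[OF 2(1)] "2.IH"[OF "2.prems"]])
  qed
qed

text \<open>Entry steps are detours: they lead to expressions from which the iteration must be
  passed again, so the iteration has an exit of its own. All other labels of interest are reset to 0
  or treated by induction.\<close>

lemma step_body_exits: "step f a \<xi> \<Longrightarrow> \<xi> = Exp f' \<Longrightarrow> body_exits f' \<Longrightarrow> body_exits f"
proof (induction arbitrary: f' rule: step.induct)
  case (2 e1 a \<xi> e2)
  obtain l where "lstep e1 a l (Exp f')"
    using step_imp_lstep[OF "2.hyps"] "2.prems"(1) by auto
  then show ?case using "2.prems"(2) by (rule body_exits.intros(2)[OF lstep.intros(2)])
next
  case (3 e2 a \<xi> e1)
  obtain l where "lstep e2 a l (Exp f')"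
    using step_imp_lstep[OF "3.hyps"] "3.prems"(1) by auto
  then show ?case using "3.prems"(2) by (rule body_exits.intros(2)[OF lstep.intros(3)])
next
  case (4 e1 a e1' e2)
  from "4.prems" have "body_exits e1'" "body_exits e2"
    by (auto simp: body_exits_Seq_iff)
  then show ?case
    using "4.IH" by (simp add: body_exits_Seq_iff)
next
  case (5 e1 a e2)
  obtain l where "lstep e1 a l Tick" using step_imp_lstep[OF "5.hyps"] by auto
  then have "lstep e1 a 0 Tick" using lstep_Tick by metis
  moreover have "body_exits e2" using "5.prems" by simp
  ultimately show ?case by (rule body_exits.intros(2)[OF lstep.intros(5)])
next
  case (6 e1 a e1' e2)
  \<comment> \<open>The target has the iteration as its right factor, so its body exit contains one
    of the iteration.\<close>
  from "6.prems" have "body_exits e1'" "body_exits (Star e1 e2)"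
    by (auto simp: body_exits_Seq_iff)
  then show ?case
    using "6.IH" by (simp add: body_exits_Seq_iff)
next
  case (8 e2 a \<xi> e1)
  obtain l where "lstep e2 a l (Exp f')"
    using step_imp_lstep[OF "8.hyps"] "8.prems"(1) by auto
  then show ?case using "8.prems"(2) by (rule body_exits.intros(2)[OF lstep.intros(9)])
qed simp_all

text \<open>Backward induction along a path to \<open>Tick\<close>, pulling the body exit back over
  each transition whatever its label.\<close>

lemma normed_imp_body_exits:
  assumes "normed f"
  shows "body_exits f"
proof -
  have "\<forall>f. \<xi> = Exp f \<longrightarrow> body_exits f" if "(\<xi>, Tick) \<in> (edges step_trans)\<^sup>*" for \<xi> :: "'a vertex"
    using that
  proof (induction rule: converse_rtrancl_induct)
    case (step \<xi> \<eta>)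
    show ?case
    proof (intro allI impI)
      fix f assume "\<xi> = Exp f"
      then obtain a where a: "step f a \<eta>" using step.hyps(1) by (auto simp: edges_def step_trans_def)
      show "body_exits f"
      proof (cases \<eta>)
        case Tick
        with a obtain l where "lstep f a l Tick" using step_imp_lstep by metis
        then have "lstep f a 0 Tick" using lstep_Tick by metis
        then show ?thesis by (rule body_exits.intros(1))
      next
        case (Exp g)
        with step.IH have "body_exits g" by simp
        then show ?thesis by (rule step_body_exits[OF a Exp])
      qed
    qed
  qed simp
  then show ?thesis using assms unfolding normed_def by blast
qed

section \<open>Termination of body steps\<close>

text \<open>The target comes first, as \<open>accp\<close> descends to smaller elements.\<close>

definition body_step :: "'a stexp \<Rightarrow> 'a stexp \<Rightarrow> bool" where
  "body_step g f \<longleftrightarrow> (\<exists>a. lstep f a 0 (Exp g))"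

text \<open>Control passes to \<open>g\<close> only if \<open>f\<close> can terminate. Guarding the
  second premise by normedness allows \<open>g\<close> to be an iteration about which nothing is
  known yet.\<close>

lemma body_terminates_Seq:
  "Wellfounded.accp body_step f \<Longrightarrow> (normed f \<Longrightarrow> Wellfounded.accp body_step g)
    \<Longrightarrow> Wellfounded.accp body_step (Seq f g)"
proof (induction rule: accp_induct_rule)
  case (1 f)
  show ?case
  proof (rule accpI)
    fix h assume "body_step h (Seq f g)"
    then obtain a where "lstep (Seq f g) a 0 (Exp h)" by (metis body_step_def)
    then consider (inner) f' where "h = Seq f' g" "lstep f a 0 (Exp f')"
      | (exit) "h = g" "lstep f a 0 Tick" by auto
    then show "Wellfounded.accp body_step h"
    proof cases
      case (inner f')
      then have "body_step f' f" by (auto simp: body_step_def)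
      \<comment> \<open>Normedness goes backward along steps, so the guarded premise carries over to
        \<open>f'\<close>.\<close>
      moreover have "normed f" if "normed f'"
        using lstep_imp_step[OF inner(2)] that by (rule normed_step_Exp)
      ultimately show ?thesis unfolding inner(1) using "1.IH" "1.prems" by simp
    next
      case exit
      have "normed f" using lstep_imp_step[OF exit(2)] by (rule normed_step_Tick)
      then show ?thesis unfolding exit(1) by (rule "1.prems")
    qed
  qed
qed

lemma successor_body_terminates: "lstep e a l (Exp f) \<Longrightarrow> Wellfounded.accp body_step f"
  \<comment> \<open>All successors of \<open>e\<close>, since body steps of sums and iterations also
    arise from entry steps of their components.\<close>
proof (induction e arbitrary: a l f)
  case (Seq e1 e2)
  have "Wellfounded.accp body_step e2"
    by (rule accpI) (auto simp: body_step_def dest: Seq.IH(2))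
  then show ?case using Seq by (auto intro: body_terminates_Seq)
next
  case (Star e1 e2)
  \<comment> \<open>No derivative of an unnormed expression is normed, so the guarded premise about
    the iteration is vacuous and there is no circularity.\<close>
  have unnormed: "Wellfounded.accp body_step (Seq f (Star e1 e2))"
    if "\<not> normed e1" "lstep e1 a l (Exp f)" for a l f
    using Star.IH(1)[OF that(2)] that
    by (auto intro: body_terminates_Seq dest: lstep_imp_step normed_step_Exp)
  \<comment> \<open>Body steps of the iteration come only from an unnormed \<open>e1\<close> or from
    \<open>e2\<close>; unfolding a normed \<open>e1\<close> carries a positive label.\<close>
  have star: "Wellfounded.accp body_step (Star e1 e2)"
    by (rule accpI) (auto simp: body_step_def dest: Star.IH(2) unnormed)
  show ?case using Star.prems Star.IH star by (auto intro: body_terminates_Seq)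
qed auto

lemma body_terminates: "Wellfounded.accp body_step e"
  by (rule accpI) (auto simp: body_step_def dest: successor_body_terminates)

text \<open>The start vertex is arbitrary, as the claim serves both for (W1) and for tails of paths
  in loop subcharts.\<close>

lemma no_infinite_body_path:
  "\<not> infinite_path (body_trans (chart_labeling A e)) \<xi> p"
proof
  assume p: "infinite_path (body_trans (chart_labeling A e)) \<xi> p"
  then have lab: "\<exists>f a. p i = Exp f \<and> lstep f a 0 (p (Suc i))" for i
    by (fastforce simp: infinite_path_def edges_def body_trans_def chart_labeling_def)
  \<comment> \<open>Accessibility induction for all positions at once: an occurrence of
    \<open>f\<close> is followed by one of a body successor of \<open>f\<close>.\<close>
  have "\<forall>i. p i \<noteq> Exp f" for f
    using body_terminates[of f]
  proof (induction rule: accp_induct_rule)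
    case (1 f)
    show ?case
    proof (intro allI notI)
      fix i assume i: "p i = Exp f"
      obtain g where "p (Suc i) = Exp g" using lab by blast
      moreover from this have "body_step g f" using lab[of i] i by (auto simp: body_step_def)
      ultimately show False using "1.IH" by blast
    qed
  qed
  then show False using lab[of 0] by blast
qed

section \<open>The chart interpretation\<close>

lemma chart_interpretation_simps [simp]:
  "verts (chart_interpretation A e) = chart_verts A e"
  "tick (chart_interpretation A e) = Tick"
  "start (chart_interpretation A e) = Exp e"
  "actions (chart_interpretation A e) = A"
  by (simp_all add: chart_interpretation_def)

text \<open>Steps introduce no new actions, so the restriction to \<open>StExp A\<close> cuts off
  nothing.\<close>

lemma chart_verts_step:
  assumes "Exp f \<in> chart_verts A e" "step f a \<xi>"
  shows "\<xi> \<in> chart_verts A e"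
proof -
  have "(Exp e, \<xi>) \<in> (edges step_trans)\<^sup>*"
  proof (rule rtrancl_into_rtrancl)
    show "(Exp e, Exp f) \<in> (edges step_trans)\<^sup>*" using assms(1) by (simp add: chart_verts_def)
    show "(Exp f, \<xi>) \<in> edges step_trans" using assms(2) by (auto simp: edges_def step_trans_def)
  qed
  moreover have "\<xi> \<in> Exp ` StExp A \<union> {Tick}"
    using assms step_acts[OF assms(2)] by (cases \<xi>) (auto simp: chart_verts_def StExp_def)
  ultimately show ?thesis by (simp add: chart_verts_def)
qed

lemma chart_labeling_iff:
  "(x, a, l, y) \<in> chart_labeling A e \<longleftrightarrow> x \<in> chart_verts A e \<and> (\<exists>f. x = Exp f \<and> lstep f a l y)"
proof (cases x)
  case (Exp f)
  have "y \<in> chart_verts A e" if "Exp f \<in> chart_verts A e" "lstep f a l y"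
    using that(1) lstep_imp_step[OF that(2)] by (rule chart_verts_step)
  then show ?thesis unfolding chart_labeling_def Exp by auto
qed (auto simp: chart_labeling_def)

lemma chart_trans_iff:
  "(x, a, y) \<in> trans (chart_interpretation A e) \<longleftrightarrow>
    x \<in> chart_verts A e \<and> (\<exists>f. x = Exp f \<and> step f a y)"
proof (cases x)
  case (Exp f)
  have "y \<in> chart_verts A e" if "Exp f \<in> chart_verts A e" "step f a y"
    using that by (rule chart_verts_step)
  then show ?thesis unfolding chart_interpretation_def step_trans_def Exp by auto
qed (auto simp: chart_interpretation_def step_trans_def)

lemma finite_chart_verts: "finite (chart_verts A e)"
proof -
  obtain F where F: "finite F" "e \<in> F" "\<forall>f\<in>F. \<forall>a f'. step f a (Exp f') \<longrightarrow> f' \<in> F"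
    using finite_step_closed[of e] by (elim exE conjE)
  have "\<xi> \<in> insert Tick (Exp ` F)" if "(Exp e, \<xi>) \<in> (edges step_trans)\<^sup>*" for \<xi>
    using that
  proof (induction rule: rtrancl_induct)
    case (step \<xi> \<eta>)
    then obtain f a where f: "f \<in> F" "Defs.step f a \<eta>"
      by (auto simp: edges_def step_trans_def)
    show ?case
    proof (cases \<eta>)
      case (Exp g)
      have "g \<in> F" using F(3)[rule_format, OF f(1)] f(2) unfolding Exp .
      then show ?thesis unfolding Exp by simp
    qed simp
  qed (use F(2) in simp)
  then have "chart_verts A e \<subseteq> insert Tick (Exp ` F)" unfolding chart_verts_def by blast
  then show ?thesis using F(1) by (auto intro: finite_subset)
qed

lemma chart_verts_acts: "Exp f \<in> chart_verts A e \<Longrightarrow> acts f \<subseteq> acts e"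
proof -
  have "\<forall>f. \<xi> = Exp f \<longrightarrow> acts f \<subseteq> acts e" if "(Exp e, \<xi>) \<in> (edges step_trans)\<^sup>*" for \<xi>
    using that
  proof (induction rule: rtrancl_induct)
    case (step \<xi> \<eta>)
    then obtain f a where "\<xi> = Exp f" "Defs.step f a \<eta>" by (auto simp: edges_def step_trans_def)
    then show ?case using step.IH step_acts[of f a \<eta>] by auto
  qed simp
  then show "Exp f \<in> chart_verts A e \<Longrightarrow> acts f \<subseteq> acts e" by (auto simp: chart_verts_def)
qed

lemma is_chart_chart_interpretation:
  assumes "e \<in> StExp A"
  shows "is_chart (chart_interpretation A e)"
proof -
  let ?C = "chart_interpretation A e"
  have start: "Exp e \<in> chart_verts A e" using assms by (auto simp: chart_verts_def)
  \<comment> \<open>The bound uses \<open>acts e\<close> rather than \<open>A\<close>, since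
    \<open>A\<close> may be infinite.\<close>
  have "(x, a, y) \<in> chart_verts A e \<times> acts e \<times> chart_verts A e"
    if "(x, a, y) \<in> trans ?C" for x a y
  proof -
    from that obtain f where f: "x = Exp f" "Exp f \<in> chart_verts A e" "step f a y"
      by (auto simp: chart_trans_iff)
    with chart_verts_step[OF f(2,3)] chart_verts_acts[OF f(2)] step_acts[OF f(3)]
    show ?thesis by blast
  qed
  then have sub: "trans ?C \<subseteq> chart_verts A e \<times> acts e \<times> chart_verts A e" by auto
  then have "finite (trans ?C)"
    by (rule finite_subset) (simp add: finite_chart_verts finite_acts)
  moreover have "acts e \<subseteq> A" using assms by (simp add: StExp_def)
  moreover have "(Exp e, \<xi>) \<in> (edges (trans ?C))\<^sup>*" if "\<xi> \<in> chart_verts A e" for \<xi>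
  proof -
    have "(Exp e, \<xi>) \<in> (edges step_trans)\<^sup>*" using that by (simp add: chart_verts_def)
    then have "\<xi> \<in> chart_verts A e \<and> (Exp e, \<xi>) \<in> (edges (trans ?C))\<^sup>*"
    proof (induction rule: rtrancl_induct)
      case (step \<xi> \<eta>)
      then obtain f a where f: "\<xi> = Exp f" "step f a \<eta>" by (auto simp: edges_def step_trans_def)
      then have "(\<xi>, \<eta>) \<in> edges (trans ?C)" using step.IH by (auto simp: edges_def chart_trans_iff)
      moreover have "\<eta> \<in> chart_verts A e" using step.IH f chart_verts_step by metis
      ultimately show ?case using step.IH by (meson rtrancl_into_rtrancl)
    qed (use start in simp)
    then show ?thesis by blast
  qed
  ultimately show ?thesis
    using start sub finite_chart_verts by (auto simp: is_chart_def chart_trans_iff)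
qed

lemma entry_body_labeling_chart_labeling:
  "entry_body_labeling (chart_interpretation A e) (chart_labeling A e)"
proof -
  have "\<exists>!n. (x, a, n, y) \<in> chart_labeling A e"
    if "(x, a, y) \<in> trans (chart_interpretation A e)" for x a y
  proof -
    from that obtain f where f: "x = Exp f" "x \<in> chart_verts A e" "step f a y"
      by (auto simp: chart_trans_iff)
    obtain n where n: "lstep f a n y" using step_imp_lstep[OF f(3)] by (elim exE)
    show ?thesis
    proof (rule ex1I)
      show "(x, a, n, y) \<in> chart_labeling A e" using f n by (simp add: chart_labeling_iff)
    next
      fix m
      assume "(x, a, m, y) \<in> chart_labeling A e"
      then have "lstep f a m y" using f(1) by (simp add: chart_labeling_iff)
      then show "m = n" using n by (rule lstep_label_unique)
    qed
  qed
  moreover have "(x, a, y) \<in> trans (chart_interpretation A e)"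
    if "(x, a, n, y) \<in> chart_labeling A e" for x a n y
    using that by (auto simp: chart_labeling_iff chart_trans_iff intro: lstep_imp_step)
  ultimately show ?thesis unfolding entry_body_labeling_def by blast
qed

section \<open>Loops\<close>

text \<open>Left-nested products: steps act on the innermost left factor, and the list of remaining
  factors is unchanged until it terminates.\<close>

abbreviation seqs :: "'a stexp \<Rightarrow> 'a stexp list \<Rightarrow> 'a stexp" where
  "seqs \<equiv> foldl Seq"

lemma lstep_seqs: "lstep f a l (Exp h) \<Longrightarrow> lstep (seqs f gs) a l (Exp (seqs h gs))"
  by (induction gs arbitrary: f h) (auto intro: lstep.intros)

text \<open>Only termination of \<open>f\<close> could give up the context. Longer contexts need no
  further condition, as a product never steps to \<open>Tick\<close>.\<close>

lemma lstep_seqs_cases: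
  assumes "lstep (seqs f gs) a l \<xi>" "\<not> lstep f a l Tick"
  obtains h where "\<xi> = Exp (seqs h gs)" "lstep f a l (Exp h)"
proof -
  have "\<exists>h. \<xi> = Exp (seqs h gs) \<and> lstep f a l (Exp h)"
    using assms
  proof (induction gs arbitrary: f)
    case Nil
    then show ?case by (cases \<xi>) auto
  next
    case (Cons g gs)
    then obtain h where h: "\<xi> = Exp (seqs h gs)" "lstep (Seq f g) a l (Exp h)"
      by (metis foldl_Cons lstep_SeqE vertex.distinct(1))
    then show ?case using Cons.prems(2) by auto
  qed
  then show thesis using that by blast
qed

text \<open>Positive labels arise only when an iteration with normed body is unfolded, and only the
  left factor of a product passes them on.\<close>

lemma entry_step_seqs_Star:
  assumes "lstep f a l \<xi>" "l > 0"
  obtains e1 e2 gs where "f = seqs (Star e1 e2) gs" "normed e1" "l = star_height e1 + 1"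
proof -
  have "\<exists>e1 e2 gs. f = seqs (Star e1 e2) gs \<and> normed e1 \<and> l = star_height e1 + 1"
    using assms
  proof (induction rule: lstep.induct)
    case (4 f a l f' g)
    then obtain e1 e2 gs where "f = seqs (Star e1 e2) gs" "normed e1" "l = star_height e1 + 1"
      by blast
    then have "Seq f g = seqs (Star e1 e2) (gs @ [g])" by simp
    then show ?case using \<open>normed e1\<close> \<open>l = star_height e1 + 1\<close> by blast
  next
    case (6 e1 a l e1' e2)
    have "Star e1 e2 = seqs (Star e1 e2) []" by simp
    then show ?case using 6 by blast
  next
    case (8 e1 a e2)
    have "Star e1 e2 = seqs (Star e1 e2) []" by simp
    then show ?case using 8 by (blast intro: normed_step_Tick lstep_imp_step)
  qed auto
  then show thesis using that by blast
qed

text \<open>To get at the factors in \<open>gs\<close>, the process would have to pass the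
  iteration, which is the vertex where the path halts.\<close>

lemma loop_trans_target:
  assumes "loop_trans (chart_labeling A e) (Exp (seqs (Star e1 e2) gs)) \<alpha> x a y" "\<alpha> > 0"
  shows "y = Exp (seqs (Star e1 e2) gs) \<or>
    (\<exists>f. y = Exp (seqs (Seq f (Star e1 e2)) gs) \<and> star_height f \<le> star_height e1)"
  using assms(1)
proof (induction rule: loop_trans.induct)
  case (enter a w)
  then have "lstep (seqs (Star e1 e2) gs) a \<alpha> w" by (simp add: chart_labeling_iff)
  moreover have "\<not> lstep (Star e1 e2) a \<alpha> Tick" using assms(2) lstep_Tick by blast
  ultimately obtain h where "w = Exp (seqs h gs)" "lstep (Star e1 e2) a \<alpha> (Exp h)"
    by (rule lstep_seqs_cases)
  \<comment> \<open>A positive level excludes the exit through \<open>e2\<close>.\<close>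
  then consider f l where "h = Seq f (Star e1 e2)" "lstep e1 a l (Exp f)" | "h = Star e1 e2"
    using assms(2) by auto
  then show ?case
  proof cases
    case (1 f l)
    have "star_height f \<le> star_height e1" using step_star_height[OF lstep_imp_step[OF 1(2)] refl] .
    then show ?thesis using 1(1) \<open>w = _\<close> by blast
  qed (use \<open>w = _\<close> in blast)
next
  case (continue x a y b z)
  then obtain f where f: "y = Exp (seqs (Seq f (Star e1 e2)) gs)" "star_height f \<le> star_height e1"
    by blast
  then have "lstep (seqs (Seq f (Star e1 e2)) gs) b 0 z"
    using continue.hyps(3) by (simp add: body_trans_def chart_labeling_iff)
  moreover have "\<not> lstep (Seq f (Star e1 e2)) b 0 Tick" by auto
  ultimately obtain h where "z = Exp (seqs h gs)" "lstep (Seq f (Star e1 e2)) b 0 (Exp h)"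
    by (rule lstep_seqs_cases)
  then consider f' where "h = Seq f' (Star e1 e2)" "lstep f b 0 (Exp f')" | "h = Star e1 e2"
    by auto
  then show ?case
  proof cases
    case (1 f')
    have "star_height f' \<le> star_height f" using step_star_height[OF lstep_imp_step[OF 1(2)] refl] .
    then have "star_height f' \<le> star_height e1" using f(2) by simp
    then show ?thesis using 1(1) \<open>z = _\<close> by blast
  qed (use \<open>z = _\<close> in blast)
qed

text \<open>The body exit of \<open>f\<close> is replayed in front of the iteration; its terminating
  step lands on \<open>v\<close>.\<close>

lemma loop_trans_returns:
  fixes e1 e2 :: "'a stexp" and gs :: "'a stexp list"
  defines "v \<equiv> Exp (seqs (Star e1 e2) gs)"
  assumes "body_exits f" "loop_trans (chart_labeling A e) v \<alpha> x a y"
    and "y = Exp (seqs (Seq f (Star e1 e2)) gs)" "y \<in> chart_verts A e"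
  shows "\<exists>x a. loop_trans (chart_labeling A e) v \<alpha> x a v"
  using assms(2-)
proof (induction arbitrary: x a y rule: body_exits.induct)
  case (1 f b)
  have "lstep (seqs (Seq f (Star e1 e2)) gs) b 0 v"
    unfolding v_def using lstep.intros(5)[OF 1(1)] by (rule lstep_seqs)
  then have body: "(y, b, v) \<in> body_trans (chart_labeling A e)"
    using "1.prems" by (simp add: body_trans_def chart_labeling_iff)
  have "loop_trans (chart_labeling A e) v \<alpha> y b v" if "y \<noteq> v"
    using "1.prems"(1) that body by (rule loop_trans.continue)
  then show ?case using "1.prems"(1) by blast
next
  case (2 f b g)
  let ?z = "Exp (seqs (Seq g (Star e1 e2)) gs)"
  have lstep: "lstep (seqs (Seq f (Star e1 e2)) gs) b 0 ?z"
    using lstep.intros(4)[OF 2(1)] by (rule lstep_seqs)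
  then have body: "(y, b, ?z) \<in> body_trans (chart_labeling A e)"
    using "2.prems" by (simp add: body_trans_def chart_labeling_iff)
  show ?case
  \<comment> \<open>If \<open>y = v\<close>, the transition at hand already returns; otherwise
    \<open>continue\<close> applies.\<close>
  proof (cases "y = v")
    case False
    with "2.prems"(1) have "loop_trans (chart_labeling A e) v \<alpha> y b ?z"
      using body by (rule loop_trans.continue)
    moreover have "?z \<in> chart_verts A e"
      using chart_verts_step[OF _ lstep_imp_step[OF lstep]] "2.prems" by simp
    ultimately show ?thesis using "2.IH" by blast
  qed (use "2.prems" in blast)
qed

lemma loop_trans_cycle:
  fixes e1 e2 :: "'a stexp" and gs :: "'a stexp list"
  defines "v \<equiv> Exp (seqs (Star e1 e2) gs)"
  assumes norm: "normed e1" and v: "v \<in> chart_verts A e" and \<alpha>: "\<alpha> = star_height e1 + 1"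
  shows "(v, v) \<in> (edges {(x, a, y). loop_trans (chart_labeling A e) v \<alpha> x a y})\<^sup>+"
proof -
  have enter: "loop_trans (chart_labeling A e) v \<alpha> v a (Exp (seqs h gs))"
    "Exp (seqs h gs) \<in> chart_verts A e"
    if "lstep (Star e1 e2) a \<alpha> (Exp h)" for a h
  proof -
    have *: "lstep (seqs (Star e1 e2) gs) a \<alpha> (Exp (seqs h gs))" using that by (rule lstep_seqs)
    then show "loop_trans (chart_labeling A e) v \<alpha> v a (Exp (seqs h gs))"
      using v by (auto simp: chart_labeling_iff v_def intro!: loop_trans.enter)
    show "Exp (seqs h gs) \<in> chart_verts A e"
      using v lstep_imp_step[OF *] unfolding v_def by (rule chart_verts_step)
  qed
  \<comment> \<open>The first step of a body exit of \<open>e1\<close> becomes an entry step of the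
    iteration of level \<alpha>; the rest of the exit leads back to \<open>v\<close>.\<close>
  have "\<exists>x a. loop_trans (chart_labeling A e) v \<alpha> x a v"
    using normed_imp_body_exits[OF norm]
  proof cases
    case (1 a)
    then have "lstep (Star e1 e2) a \<alpha> (Exp (Star e1 e2))" unfolding \<alpha> by (rule lstep.intros)
    from enter(1)[OF this] show ?thesis unfolding v_def by blast
  next
    case (2 a f)
    then have "lstep (Star e1 e2) a \<alpha> (Exp (Seq f (Star e1 e2)))"
      unfolding \<alpha> using norm by (intro lstep.intros)
    from loop_trans_returns[OF 2(2) enter(1)[OF this, unfolded v_def] refl enter(2)[OF this]]
    show ?thesis unfolding v_def by blast
  qed
  then obtain x a where x: "loop_trans (chart_labeling A e) v \<alpha> x a v" by blast
  then have "(x, v) \<in> edges {(x, a, y). loop_trans (chart_labeling A e) v \<alpha> x a y}"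
    by (auto simp: edges_def)
  with loop_trans_reachable[OF x] show ?thesis by (rule rtrancl_into_trancl1)
qed

text \<open>Transitions that depart from a vertex other than \<open>v\<close> are body transitions,
  so a path that never returns would have an infinite tail of body steps. The tail starts at
  \<open>p 1\<close>, since the first transition is an entry.\<close>

lemma loop_subchart_returns:
  assumes "infinite_path (trans (loop_subchart C (chart_labeling A e) v \<alpha>)) v p"
  shows "\<exists>i>0. p i = v"
proof (rule ccontr)
  assume "\<not> ?thesis"
  then have "p (Suc i) \<noteq> v" for i by auto
  moreover have "(p (Suc i), p (Suc (Suc i))) \<in> edges {(x, a, y). loop_trans (chart_labeling A e) v \<alpha> x a y}" for i
    using assms by (simp add: infinite_path_def trans_loop_subchart)
  ultimately have "(p (Suc i), p (Suc (Suc i))) \<in> edges (body_trans (chart_labeling A e))" for i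
    by (fastforce simp: edges_def dest: loop_trans_body)
  then have "infinite_path (body_trans (chart_labeling A e)) (p 1) (\<lambda>i. p (Suc i))"
    by (simp add: infinite_path_def)
  then show False using no_infinite_body_path by blast
qed

theorem proposition3p7:
  fixes A :: "'a set" and e :: "'a stexp"
  assumes "e \<in> StExp A"
  shows "LLEE_witness (chart_interpretation A e) (chart_labeling A e)"
proof -
  let ?C = "chart_interpretation A e" and ?L = "chart_labeling A e"
  note C = is_chart_chart_interpretation[OF assms]
  note L = entry_body_labeling_chart_labeling[of A e]
  have "loop_chart (loop_subchart ?C ?L v \<alpha>) \<and>
      (\<forall>w \<in> verts (loop_subchart ?C ?L v \<alpha>). w \<noteq> v \<longrightarrow> (\<forall>\<beta>\<ge>\<alpha>. \<not> entry_departs ?L w \<beta>))"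
    if v: "v \<in> chart_verts A e" and entry: "entry_departs ?L v \<alpha>" for v \<alpha>
  proof -
    obtain h a \<xi> where h: "v = Exp h" "lstep h a \<alpha> \<xi>" and pos: "\<alpha> > 0"
      using entry by (auto simp: entry_departs_def chart_labeling_iff)
    obtain e1 e2 gs where "h = seqs (Star e1 e2) gs"
      and norm: "normed e1" and \<alpha>: "\<alpha> = star_height e1 + 1"
      using entry_step_seqs_Star[OF h(2) pos] .
    with h have v_eq: "v = Exp (seqs (Star e1 e2) gs)" by simp
    have w: "\<exists>f. w = Exp (seqs (Seq f (Star e1 e2)) gs) \<and> star_height f \<le> star_height e1"
      if wv: "w \<in> verts (loop_subchart ?C ?L v \<alpha>)" "w \<noteq> v" for w
    proof -
      obtain x b where xb: "loop_trans ?L v \<alpha> x b w"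
        using loop_subchart_vert_target[OF wv] by blast
      show ?thesis using loop_trans_target[OF xb[unfolded v_eq] pos] wv(2) unfolding v_eq by simp
    qed
    have "Tick \<notin> verts (loop_subchart ?C ?L v \<alpha>)" using w[of Tick] h(1) by auto
    moreover have "is_chart (loop_subchart ?C ?L v \<alpha>)"
      using is_chart_loop_subchart[OF C L entry] .
    moreover have "\<exists>p. infinite_path (trans (loop_subchart ?C ?L v \<alpha>)) v p"
      unfolding trans_loop_subchart using v norm \<alpha> unfolding v_eq
      by (intro infinite_path_of_cycle loop_trans_cycle)
    moreover have "\<not> entry_departs ?L w \<beta>"
      if wv: "w \<in> verts (loop_subchart ?C ?L v \<alpha>)" "w \<noteq> v"
        and "\<beta> \<ge> \<alpha>" for w \<beta>
    proof
      assume entry_w: "entry_departs ?L w \<beta>"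
      obtain f where f: "w = Exp (seqs (Seq f (Star e1 e2)) gs)" "star_height f \<le> star_height e1"
        using w[OF wv] by blast
      then obtain b y where "lstep (seqs (Seq f (Star e1 e2)) gs) b \<beta> y"
        using entry_w by (auto simp: entry_departs_def chart_labeling_iff)
      moreover have "\<not> lstep (Seq f (Star e1 e2)) b \<beta> Tick" by auto
      ultimately obtain k where "lstep (Seq f (Star e1 e2)) b \<beta> (Exp k)"
        by (rule lstep_seqs_cases)
      \<comment> \<open>A step of the product is a step of \<open>f\<close> with the same label or
        the passage to the iteration with label 0; in both cases \<beta> is at most
        \<open>star_height f\<close>, hence less than \<alpha>.\<close>
      then consider f' where "lstep f b \<beta> (Exp f')" | "\<beta> = 0" by auto
      then have "\<beta> \<le> star_height f" by cases (simp_all add: lstep_level_le)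
      then show False using f(2) \<alpha> \<open>\<beta> \<ge> \<alpha>\<close> by simp
    qed
    ultimately show ?thesis
      unfolding loop_chart_def using loop_subchart_returns[of ?C A e v \<alpha>] by simp
  qed
  then show ?thesis
    unfolding LLEE_witness_def using C L no_infinite_body_path[of A e "Exp e"] by auto
qed

end
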